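(* Let $\langle \mathsf B,\mathcal F\rangle$ be a display map category with $\mathcal F$-dependent coproducts, and $\mathsf p:\mathsf E\to\mathsf B$ a dependent Hilbert $\epsilon$-fibration. Then for every object $\alpha\in\mathsf E_I$ and every display map $f:I\twoheadrightarrow J$, there exists a vertical arrow $\overline{\epsilon}_{\alpha,f}:\coprod_f\alpha\to(\epsilon_{\alpha,f})^*\alpha$, and it is an isomorphism.
   Context: Fibrations $\mathsf p:\mathsf E\to\mathsf B$ are cloven Grothendieck fibrations; $\mathsf E_A$ is the fibre over $A$; vertical arrows are those over identities; $u^*$ is reindexing along $u$; canonical isomorphisms such as $g^*u^*\cong(ug)^*$ are suppressed. A display map category $\langle\mathsf B,\mathcal F\rangle$ is a category with a class $\mathcal F$ of morphisms (display maps, written $\twoheadrightarrow$) such that pullbacks of $\mathcal F$-maps along arbitrary maps exist and lie in $\mathcal F$. It has $\mathcal F$-dependent coproducts if $\mathcal F$ is closed under composition. $\mathsf p$ has fibred coproducts along $\mathcal F$ if for each $v\in\mathcal F$ the functor $v^*$ has a left adjoint $\coprod_v$ and, for every pullback square with $v:L\twoheadrightarrow J$, $f:I\to J$ arbitrary, $u:K\twoheadrightarrow I$, $g:K\to L$, the canonical map $\coprod_u g^*\Rightarrow f^*\coprod_v$ is an isomorphism (Beck–Chevalley). $\alpha\in\mathsf E_A$ is $(\mathcal F,\coprod)$-quantifier splitting if for every $u:B\twoheadrightarrow A$ in $\mathcal F$, every $\beta\in\mathsf E_B$ and every vertical $h:\alpha\to\coprod_u\beta$ there exist a unique section $g:A\to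 B$ of $u$ and a unique vertical $\overline h:\alpha\to g^*\beta$ with $h=g^*(\eta_\beta)\circ\overline h$, where $\eta$ is the unit of $\coprod_u\dashv u^*$ and $g^*u^*\coprod_u\beta\cong\coprod_u\beta$. It is $(\mathcal F,\coprod)$-quantifier-free if $f^*\alpha$ is $(\mathcal F,\coprod)$-quantifier splitting for every $f:I\to A$ in $\mathsf B$. $\mathsf p$ is a dependent Hilbert $\epsilon$-fibration if $\langle\mathsf B,\mathcal F\rangle$ has $\mathcal F$-dependent coproducts, $\mathsf p$ has fibred coproducts along $\mathcal F$, and every object of $\mathsf E$ is $(\mathcal F,\coprod)$-quantifier-free. For such $\mathsf p$, $\alpha\in\mathsf E_I$ and $f:I\twoheadrightarrow J$ in $\mathcal F$, the pair $(\epsilon_{\alpha,f},\overline{\epsilon}_{\alpha,f})$ denotes the unique section $\epsilon_{\alpha,f}:J\to I$ of $f$ and unique vertical arrow $\overline{\epsilon}_{\alpha,f}:\coprod_f\alpha\to(\epsilon_{\alpha,f})^*\alpha$ with $(\epsilon_{\alpha,f})^*\eta_\alpha\circ\overline{\epsilon}_{\alpha,f}=\mathrm{id}_{\coprod_f\alpha}$, where $\eta$ is the unit of $\coprod_f\dashv f^*$. *)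

theory Defs
  imports Main
begin

section \<open>Categories, functors, adjunctions\<close>

text \<open>
  Categories have explicit carriers. Operations are only constrained on these
  carriers; \<open>g \<cdot>\<^bsub>C\<^esub> f\<close> is composition in the usual order, \<open>f\<close> first.
\<close>

record ('o, 'a) cat =
  Ob :: "'o set"
  Arr :: "'a set"
  dom :: "'a \<Rightarrow> 'o"
  cod :: "'a \<Rightarrow> 'o"
  ide :: "'o \<Rightarrow> 'a"
  comp :: "'a \<Rightarrow> 'a \<Rightarrow> 'a"  (infixr "\<cdot>\<index>" 70)

definition hom :: "('o, 'a) cat \<Rightarrow> 'o \<Rightarrow> 'o \<Rightarrow> 'a set" where
  "hom C x y = {f \<in> Arr C. dom C f = x \<and> cod C f = y}"

locale category =
  fixes C :: "('o, 'a) cat"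
  assumes dom_ob: "f \<in> Arr C \<Longrightarrow> dom C f \<in> Ob C"
    and cod_ob: "f \<in> Arr C \<Longrightarrow> cod C f \<in> Ob C"
    and ide_hom: "x \<in> Ob C \<Longrightarrow> ide C x \<in> hom C x x"
    and comp_hom: "f \<in> hom C x y \<Longrightarrow> g \<in> hom C y z \<Longrightarrow> g \<cdot>\<^bsub>C\<^esub> f \<in> hom C x z"
    and comp_ide_right: "f \<in> hom C x y \<Longrightarrow> f \<cdot>\<^bsub>C\<^esub> ide C x = f"
    and comp_ide_left: "f \<in> hom C x y \<Longrightarrow> ide C y \<cdot>\<^bsub>C\<^esub> f = f"
    and comp_assoc: "f \<in> hom C w x \<Longrightarrow> g \<in> hom C x y \<Longrightarrow> h \<in> hom C y z \<Longrightarrow>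
      (h \<cdot>\<^bsub>C\<^esub> g) \<cdot>\<^bsub>C\<^esub> f = h \<cdot>\<^bsub>C\<^esub> (g \<cdot>\<^bsub>C\<^esub> f)"

definition inverse_arrows :: "('o, 'a) cat \<Rightarrow> 'a \<Rightarrow> 'a \<Rightarrow> bool" where
  "inverse_arrows C f g \<longleftrightarrow>
     f \<in> Arr C \<and> g \<in> hom C (cod C f) (dom C f) \<and>
     g \<cdot>\<^bsub>C\<^esub> f = ide C (dom C f) \<and> f \<cdot>\<^bsub>C\<^esub> g = ide C (cod C f)"

definition is_iso :: "('o, 'a) cat \<Rightarrow> 'a \<Rightarrow> bool" where
  "is_iso C f \<longleftrightarrow> (\<exists>g. inverse_arrows C f g)"

definition inv_arrow :: "('o, 'a) cat \<Rightarrow> 'a \<Rightarrow> 'a" where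
  "inv_arrow C f = (THE g. inverse_arrows C f g)"

definition is_pullback :: "('o, 'a) cat \<Rightarrow> 'a \<Rightarrow> 'a \<Rightarrow> 'a \<Rightarrow> 'a \<Rightarrow> bool" where
  \<comment> \<open>\<open>v \<cdot> g = f \<cdot> u\<close>, with \<open>u\<close> the pullback of \<open>v\<close> along \<open>f\<close>\<close>
  "is_pullback C v f g u \<longleftrightarrow>
     v \<in> Arr C \<and> f \<in> hom C (dom C f) (cod C v) \<and>
     g \<in> hom C (dom C u) (dom C v) \<and> u \<in> hom C (dom C u) (dom C f) \<and>
     v \<cdot>\<^bsub>C\<^esub> g = f \<cdot>\<^bsub>C\<^esub> u \<and>
     (\<forall>x \<in> Ob C. \<forall>s \<in> hom C x (dom C v). \<forall>t \<in> hom C x (dom C f).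
        v \<cdot>\<^bsub>C\<^esub> s = f \<cdot>\<^bsub>C\<^esub> t \<longrightarrow>
        (\<exists>!m. m \<in> hom C x (dom C u) \<and> g \<cdot>\<^bsub>C\<^esub> m = s \<and> u \<cdot>\<^bsub>C\<^esub> m = t))"

record ('o, 'a, 'o2, 'a2) func =
  fob :: "'o \<Rightarrow> 'o2"
  farr :: "'a \<Rightarrow> 'a2"

locale is_functor =
  fixes C :: "('o, 'a) cat" and D :: "('o2, 'a2) cat" and F :: "('o, 'a, 'o2, 'a2) func"
  assumes fob_ob: "x \<in> Ob C \<Longrightarrow> fob F x \<in> Ob D"
    and farr_hom: "f \<in> hom C x y \<Longrightarrow> farr F f \<in> hom D (fob F x) (fob F y)"
    and farr_ide: "x \<in> Ob C \<Longrightarrow> farr F (ide C x) = ide D (fob F x)"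
    and farr_comp: "f \<in> hom C x y \<Longrightarrow> g \<in> hom C y z \<Longrightarrow>
      farr F (g \<cdot>\<^bsub>C\<^esub> f) = farr F g \<cdot>\<^bsub>D\<^esub> farr F f"

definition id_func :: "('o, 'a, 'o, 'a) func" where
  "id_func = \<lparr>fob = (\<lambda>x. x), farr = (\<lambda>f. f)\<rparr>"

definition comp_func ::
  "('o2, 'a2, 'o3, 'a3) func \<Rightarrow> ('o, 'a, 'o2, 'a2) func \<Rightarrow> ('o, 'a, 'o3, 'a3) func" where
  "comp_func G F = \<lparr>fob = (\<lambda>x. fob G (fob F x)), farr = (\<lambda>f. farr G (farr F f))\<rparr>"

locale nat_trans =
  fixes C :: "('o, 'a) cat" and D :: "('o2, 'a2) cat"
    and F G :: "('o, 'a, 'o2, 'a2) func" and \<tau> :: "'o \<Rightarrow> 'a2"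
  assumes component: "x \<in> Ob C \<Longrightarrow> \<tau> x \<in> hom D (fob F x) (fob G x)"
    and naturality: "f \<in> hom C x y \<Longrightarrow> \<tau> y \<cdot>\<^bsub>D\<^esub> farr F f = farr G f \<cdot>\<^bsub>D\<^esub> \<tau> x"

locale adjunction =
  fixes C :: "('o, 'a) cat" and D :: "('o2, 'a2) cat"
    and F :: "('o, 'a, 'o2, 'a2) func" and G :: "('o2, 'a2, 'o, 'a) func"
    and \<eta> :: "'o \<Rightarrow> 'a" and \<theta> :: "'o2 \<Rightarrow> 'a2"
  assumes left_functor: "is_functor C D F"
    and right_functor: "is_functor D C G"
    and unit_nat: "nat_trans C C id_func (comp_func G F) \<eta>"
    and counit_nat: "nat_trans D D (comp_func F G) id_func \<theta>"
    and triangle_left: "x \<in> Ob C \<Longrightarrow> \<theta> (fob F x) \<cdot>\<^bsub>D\<^esub> farr F (\<eta> x) = ide D (fob F x)"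
    and triangle_right: "y \<in> Ob D \<Longrightarrow> farr G (\<theta> y) \<cdot>\<^bsub>C\<^esub> \<eta> (fob G y) = ide C (fob G y)"

section \<open>Cloven fibrations\<close>

text \<open>The cleavage \<open>lift P u X\<close> is the chosen cartesian arrow over \<open>u\<close> with codomain \<open>X\<close>.\<close>

record ('bo, 'ba, 'eo, 'ea) fibration =
  base :: "('bo, 'ba) cat"
  total :: "('eo, 'ea) cat"
  proj :: "('eo, 'ea, 'bo, 'ba) func"
  lift :: "'ba \<Rightarrow> 'eo \<Rightarrow> 'ea"

definition is_cartesian :: "('bo, 'ba, 'eo, 'ea) fibration \<Rightarrow> 'ea \<Rightarrow> bool" where
  "is_cartesian P \<phi> \<longleftrightarrow>
     \<phi> \<in> Arr (total P) \<and>
     (\<forall>\<psi> \<in> Arr (total P). cod (total P) \<psi> = cod (total P) \<phi> \<longrightarrow>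
       (\<forall>w \<in> hom (base P) (fob (proj P) (dom (total P) \<psi>)) (fob (proj P) (dom (total P) \<phi>)).
          farr (proj P) \<phi> \<cdot>\<^bsub>base P\<^esub> w = farr (proj P) \<psi> \<longrightarrow>
          (\<exists>!\<chi>. \<chi> \<in> hom (total P) (dom (total P) \<psi>) (dom (total P) \<phi>) \<and>
             farr (proj P) \<chi> = w \<and> \<phi> \<cdot>\<^bsub>total P\<^esub> \<chi> = \<psi>)))"

locale cloven_fibration =
  fixes P :: "('bo, 'ba, 'eo, 'ea) fibration"
  assumes base_category: "category (base P)"
    and total_category: "category (total P)"
    and proj_functor: "is_functor (total P) (base P) (proj P)"
    and lift_arr: "u \<in> Arr (base P) \<Longrightarrow> X \<in> Ob (total P) \<Longrightarrow>
      fob (proj P) X = cod (base P) u \<Longrightarrow> lift P u X \<in> Arr (total P)"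
    and lift_cod: "u \<in> Arr (base P) \<Longrightarrow> X \<in> Ob (total P) \<Longrightarrow>
      fob (proj P) X = cod (base P) u \<Longrightarrow> cod (total P) (lift P u X) = X"
    and lift_proj: "u \<in> Arr (base P) \<Longrightarrow> X \<in> Ob (total P) \<Longrightarrow>
      fob (proj P) X = cod (base P) u \<Longrightarrow> farr (proj P) (lift P u X) = u"
    and lift_cartesian: "u \<in> Arr (base P) \<Longrightarrow> X \<in> Ob (total P) \<Longrightarrow>
      fob (proj P) X = cod (base P) u \<Longrightarrow> is_cartesian P (lift P u X)"

definition fibre :: "('bo, 'ba, 'eo, 'ea) fibration \<Rightarrow> 'bo \<Rightarrow> ('eo, 'ea) cat" where
  "fibre P A =
     \<lparr>Ob = {X \<in> Ob (total P). fob (proj P) X = A},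
      Arr = {k \<in> Arr (total P). farr (proj P) k = ide (base P) A \<and>
               fob (proj P) (dom (total P) k) = A \<and> fob (proj P) (cod (total P) k) = A},
      dom = dom (total P), cod = cod (total P), ide = ide (total P), comp = comp (total P)\<rparr>"

text \<open>For \<open>\<phi>\<close> cartesian and \<open>\<psi>\<close> over the same arrow with the same codomain: the unique
  vertical arrow \<open>k\<close> with \<open>\<phi> \<cdot> k = \<psi>\<close>.\<close>

definition vert_factor :: "('bo, 'ba, 'eo, 'ea) fibration \<Rightarrow> 'ea \<Rightarrow> 'ea \<Rightarrow> 'ea" where
  "vert_factor P \<phi> \<psi> =
     (THE k. k \<in> hom (fibre P (fob (proj P) (dom (total P) \<psi>)))
                   (dom (total P) \<psi>) (dom (total P) \<phi>) \<and>
             \<phi> \<cdot>\<^bsub>total P\<^esub> k = \<psi>)"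

definition reindex :: "('bo, 'ba, 'eo, 'ea) fibration \<Rightarrow> 'ba \<Rightarrow> ('eo, 'ea, 'eo, 'ea) func" where
  "reindex P u =
     \<lparr>fob = (\<lambda>X. dom (total P) (lift P u X)),
      farr = (\<lambda>k. vert_factor P (lift P u (cod (total P) k))
                     (k \<cdot>\<^bsub>total P\<^esub> lift P u (dom (total P) k)))\<rparr>"

text \<open>The canonical isomorphism \<open>g\<^sup>* (u\<^sup>* X) \<rightarrow> (u \<cdot> g)\<^sup>* X\<close>.\<close>

definition reindex_comp_iso ::
  "('bo, 'ba, 'eo, 'ea) fibration \<Rightarrow> 'ba \<Rightarrow> 'ba \<Rightarrow> 'eo \<Rightarrow> 'ea" where
  "reindex_comp_iso P u g X =
     vert_factor P (lift P (u \<cdot>\<^bsub>base P\<^esub> g) X)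
       (lift P u X \<cdot>\<^bsub>total P\<^esub> lift P g (fob (reindex P u) X))"

text \<open>For a section \<open>g\<close> of \<open>u\<close>, the canonical isomorphism
  \<open>g\<^sup>* (u\<^sup>* X) \<rightarrow> (u \<cdot> g)\<^sup>* X = id\<^sup>* X \<rightarrow> X\<close>; its second factor is the lift of the identity.\<close>

definition section_iso ::
  "('bo, 'ba, 'eo, 'ea) fibration \<Rightarrow> 'ba \<Rightarrow> 'ba \<Rightarrow> 'eo \<Rightarrow> 'ea" where
  "section_iso P u g X =
     lift P (ide (base P) (fob (proj P) X)) X \<cdot>\<^bsub>total P\<^esub> reindex_comp_iso P u g X"

section \<open>Display maps and fibred coproducts\<close>

locale display_map_category =
  fixes B :: "('bo, 'ba) cat" and F :: "'ba set"
  assumes base_is_category: "category B"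
    and display_arr: "F \<subseteq> Arr B"
    and pullback_exists: "v \<in> F \<Longrightarrow> f \<in> Arr B \<Longrightarrow> cod B f = cod B v \<Longrightarrow>
      \<exists>g u. is_pullback B v f g u"
    and pullback_display: "v \<in> F \<Longrightarrow> is_pullback B v f g u \<Longrightarrow> u \<in> F"

definition has_dependent_coproducts :: "('bo, 'ba) cat \<Rightarrow> 'ba set \<Rightarrow> bool" where
  "has_dependent_coproducts B F \<longleftrightarrow>
     (\<forall>u \<in> F. \<forall>v \<in> F. cod B u = dom B v \<longrightarrow> v \<cdot>\<^bsub>B\<^esub> u \<in> F)"

record ('ba, 'eo, 'ea) coproducts =
  coprod :: "'ba \<Rightarrow> ('eo, 'ea, 'eo, 'ea) func"
  unit :: "'ba \<Rightarrow> 'eo \<Rightarrow> 'ea"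
  counit :: "'ba \<Rightarrow> 'eo \<Rightarrow> 'ea"

text \<open>
  The component at \<open>\<beta>\<close> of the canonical map \<open>\<Coprod>\<^sub>u g\<^sup>* \<Rightarrow> f\<^sup>* \<Coprod>\<^sub>v\<close> for a commutative square
  \<open>v \<cdot> g = f \<cdot> u\<close>, i.e. the transpose along \<open>\<Coprod>\<^sub>u \<stileturn> u\<^sup>*\<close> of
  \<open>g\<^sup>* \<beta> \<rightarrow> g\<^sup>* (v\<^sup>* (\<Coprod>\<^sub>v \<beta>)) \<cong> (v \<cdot> g)\<^sup>* (\<Coprod>\<^sub>v \<beta>) = (f \<cdot> u)\<^sup>* (\<Coprod>\<^sub>v \<beta>) \<cong> u\<^sup>* (f\<^sup>* (\<Coprod>\<^sub>v \<beta>))\<close>.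
\<close>

definition beck_chevalley_map ::
  "('bo, 'ba, 'eo, 'ea) fibration \<Rightarrow> ('ba, 'eo, 'ea) coproducts \<Rightarrow>
   'ba \<Rightarrow> 'ba \<Rightarrow> 'ba \<Rightarrow> 'ba \<Rightarrow> 'eo \<Rightarrow> 'ea" where
  "beck_chevalley_map P Q v f g u \<beta> =
     (let X = fob (coprod Q v) \<beta>;
          m = inv_arrow (fibre P (dom (base P) u)) (reindex_comp_iso P f u X)
              \<cdot>\<^bsub>total P\<^esub> reindex_comp_iso P v g X
              \<cdot>\<^bsub>total P\<^esub> farr (reindex P g) (unit Q v \<beta>)
      in counit Q u (fob (reindex P f) X) \<cdot>\<^bsub>total P\<^esub> farr (coprod Q u) m)"

locale fibred_coproducts = cloven_fibration P
  for P :: "('bo, 'ba, 'eo, 'ea) fibration" +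
  fixes F :: "'ba set" and Q :: "('ba, 'eo, 'ea) coproducts"
  assumes coprod_adjunction: "v \<in> F \<Longrightarrow>
      adjunction (fibre P (dom (base P) v)) (fibre P (cod (base P) v))
        (coprod Q v) (reindex P v) (unit Q v) (counit Q v)"
    and beck_chevalley: "v \<in> F \<Longrightarrow> u \<in> F \<Longrightarrow> is_pullback (base P) v f g u \<Longrightarrow>
      \<beta> \<in> Ob (fibre P (dom (base P) v)) \<Longrightarrow>
      is_iso (fibre P (dom (base P) f)) (beck_chevalley_map P Q v f g u \<beta>)"

section \<open>Quantifier-free objects and dependent Hilbert epsilon-fibrations\<close>

text \<open>\<open>g\<close> is a section of \<open>u\<close>, and \<open>k : \<alpha> \<rightarrow> g\<^sup>* \<beta>\<close> is a vertical arrow with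
  \<open>h = g\<^sup>* \<eta>\<^sub>\<beta> \<cdot> k\<close> modulo the canonical isomorphism; \<open>\<alpha>\<close> is the domain of \<open>h\<close>.\<close>

definition unit_factorisation ::
  "('bo, 'ba, 'eo, 'ea) fibration \<Rightarrow> ('ba, 'eo, 'ea) coproducts \<Rightarrow>
   'ba \<Rightarrow> 'eo \<Rightarrow> 'ea \<Rightarrow> 'ba \<Rightarrow> 'ea \<Rightarrow> bool" where
  "unit_factorisation P Q u \<beta> h g k \<longleftrightarrow>
     g \<in> hom (base P) (cod (base P) u) (dom (base P) u) \<and>
     u \<cdot>\<^bsub>base P\<^esub> g = ide (base P) (cod (base P) u) \<and>
     k \<in> hom (fibre P (cod (base P) u)) (dom (total P) h) (fob (reindex P g) \<beta>) \<and>
     h = section_iso P u g (fob (coprod Q u) \<beta>)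
         \<cdot>\<^bsub>total P\<^esub> farr (reindex P g) (unit Q u \<beta>) \<cdot>\<^bsub>total P\<^esub> k"

definition quantifier_splitting ::
  "('bo, 'ba, 'eo, 'ea) fibration \<Rightarrow> 'ba set \<Rightarrow> ('ba, 'eo, 'ea) coproducts \<Rightarrow> 'eo \<Rightarrow> bool" where
  "quantifier_splitting P F Q \<alpha> \<longleftrightarrow>
     (\<forall>u \<in> F. cod (base P) u = fob (proj P) \<alpha> \<longrightarrow>
       (\<forall>\<beta> \<in> Ob (fibre P (dom (base P) u)).
        \<forall>h \<in> hom (fibre P (cod (base P) u)) \<alpha> (fob (coprod Q u) \<beta>).
          \<exists>!(g, k). unit_factorisation P Q u \<beta> h g k))"

definition quantifier_free ::
  "('bo, 'ba, 'eo, 'ea) fibration \<Rightarrow> 'ba set \<Rightarrow> ('ba, 'eo, 'ea) coproducts \<Rightarrow> 'eo \<Rightarrow> bool" where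
  "quantifier_free P F Q \<alpha> \<longleftrightarrow>
     (\<forall>f \<in> Arr (base P). cod (base P) f = fob (proj P) \<alpha> \<longrightarrow>
        quantifier_splitting P F Q (fob (reindex P f) \<alpha>))"

locale dependent_hilbert_fibration =
  display_map_category "base P" F + fibred_coproducts P F Q
  for P :: "('bo, 'ba, 'eo, 'ea) fibration" and F :: "'ba set"
    and Q :: "('ba, 'eo, 'ea) coproducts" +
  assumes dependent_coproducts: "has_dependent_coproducts (base P) F"
    and all_quantifier_free: "\<alpha> \<in> Ob (total P) \<Longrightarrow> quantifier_free P F Q \<alpha>"

definition epsilon_pair ::
  "('bo, 'ba, 'eo, 'ea) fibration \<Rightarrow> ('ba, 'eo, 'ea) coproducts \<Rightarrow> 'eo \<Rightarrow> 'ba \<Rightarrow> 'ba \<times> 'ea" where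
  "epsilon_pair P Q \<alpha> f =
     (THE (g, k). unit_factorisation P Q f \<alpha> (ide (total P) (fob (coprod Q f) \<alpha>)) g k)"

definition epsilon ::
  "('bo, 'ba, 'eo, 'ea) fibration \<Rightarrow> ('ba, 'eo, 'ea) coproducts \<Rightarrow> 'eo \<Rightarrow> 'ba \<Rightarrow> 'ba" where
  "epsilon P Q \<alpha> f = fst (epsilon_pair P Q \<alpha> f)"

definition epsilon_bar ::
  "('bo, 'ba, 'eo, 'ea) fibration \<Rightarrow> ('ba, 'eo, 'ea) coproducts \<Rightarrow> 'eo \<Rightarrow> 'ba \<Rightarrow> 'ea" where
  "epsilon_bar P Q \<alpha> f = snd (epsilon_pair P Q \<alpha> f)"

end

theory Submission
  imports Defs
begin

text \<open>
  Write \<open>g\<close> for the section \<open>\<epsilon>\<close>, \<open>k\<close> for the arrow \<open>\<epsilon>\<close>-bar and \<open>r : g\<^sup>* \<alpha> \<rightarrow> \<Coprod>\<^sub>f \<alpha>\<close> for the reindexed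
  unit, so that \<open>r \<cdot> k = id\<close>. Then \<open>r = r \<cdot> id\<close> and \<open>r = r \<cdot> (k \<cdot> r)\<close> are two factorisations of \<open>r\<close>
  through the unit with the same section \<open>g\<close>. Since \<open>g\<^sup>* \<alpha>\<close> is quantifier splitting, they agree,
  whence \<open>k \<cdot> r = id\<close>.
\<close>

section \<open>Inverse arrows and the arrows of a fibre\<close>

lemma inverse_arrowsD:
  assumes "inverse_arrows C f g" "f \<in> hom C x y"
  shows "g \<in> hom C y x" "g \<cdot>\<^bsub>C\<^esub> f = ide C x" "f \<cdot>\<^bsub>C\<^esub> g = ide C y"
  using assms by (auto simp: inverse_arrows_def hom_def)

text \<open>A fibre inherits its operations from \<open>total P\<close>, so with these rules the
  category laws of a fibre apply to composites written in \<open>total P\<close>.\<close>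

lemma fibre_simps [simp]:
  "dom (fibre P A) = dom (total P)" "cod (fibre P A) = cod (total P)"
  "ide (fibre P A) = ide (total P)" "comp (fibre P A) = comp (total P)"
  by (simp_all add: fibre_def)

lemma mem_Ob_fibre_iff: "X \<in> Ob (fibre P A) \<longleftrightarrow> X \<in> Ob (total P) \<and> fob (proj P) X = A"
  by (simp add: fibre_def)

lemma mem_hom_fibre_iff:
  "k \<in> hom (fibre P A) X Y \<longleftrightarrow>
     k \<in> hom (total P) X Y \<and> farr (proj P) k = ide (base P) A \<and>
     fob (proj P) X = A \<and> fob (proj P) Y = A"
  by (auto simp: fibre_def hom_def)

section \<open>Fibres as categories and vertical factorisation through cartesian arrows\<close>

context cloven_fibration
begin

lemma hom_total_ob:
  assumes "k \<in> hom (total P) X Y"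
  shows "X \<in> Ob (total P)" "Y \<in> Ob (total P)"
  using assms category.dom_ob[OF total_category] category.cod_ob[OF total_category]
  by (auto simp: hom_def)

lemma hom_fibre_ob:
  assumes "k \<in> hom (fibre P A) X Y"
  shows "X \<in> Ob (fibre P A)" "Y \<in> Ob (fibre P A)"
  using assms hom_total_ob by (auto simp: mem_hom_fibre_iff mem_Ob_fibre_iff)

lemma fob_proj_ob: "X \<in> Ob (total P) \<Longrightarrow> fob (proj P) X \<in> Ob (base P)"
  using is_functor.fob_ob[OF proj_functor] .

lemma base_ob:
  assumes "X \<in> Ob (fibre P A)"
  shows "A \<in> Ob (base P)"
  using assms fob_proj_ob[of X] by (simp add: mem_Ob_fibre_iff)

lemma fibre_category: "category (fibre P A)"
proof -
  interpret T: category "total P" by (rule total_category)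
  interpret B: category "base P" by (rule base_category)
  show ?thesis
  proof
    fix k assume "k \<in> Arr (fibre P A)"
    then show "dom (fibre P A) k \<in> Ob (fibre P A)" "cod (fibre P A) k \<in> Ob (fibre P A)"
      using T.dom_ob T.cod_ob by (auto simp: fibre_def)
  next
    fix X assume "X \<in> Ob (fibre P A)"
    then show "ide (fibre P A) X \<in> hom (fibre P A) X X"
      using T.ide_hom is_functor.farr_ide[OF proj_functor]
      by (auto simp: mem_hom_fibre_iff mem_Ob_fibre_iff)
  next
    fix k l X Y Z assume k: "k \<in> hom (fibre P A) X Y" and l: "l \<in> hom (fibre P A) Y Z"
    \<comment> \<open>Vertical arrows compose to a vertical one because \<open>ide A\<close> is
      idempotent; \<open>A\<close> is an object of the base since \<open>X\<close> lies over
      it.\<close>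
    have A: "A \<in> Ob (base P)" by (rule base_ob[OF hom_fibre_ob(1)[OF k]])
    show "l \<cdot>\<^bsub>fibre P A\<^esub> k \<in> hom (fibre P A) X Z"
      using k l T.comp_hom is_functor.farr_comp[OF proj_functor]
        B.comp_ide_left[OF B.ide_hom[OF A]]
      by (auto simp: mem_hom_fibre_iff)
  qed (auto simp: mem_hom_fibre_iff T.comp_ide_left T.comp_ide_right T.comp_assoc)
qed

text \<open>This is the universal property of \<phi> with the identity as the base arrow
  \<open>w\<close>; the unique lift of an identity is vertical.\<close>

lemma cartesian_vert_factor_ex1:
  assumes "is_cartesian P \<phi>" "\<psi> \<in> Arr (total P)" "cod (total P) \<psi> = cod (total P) \<phi>"
    "farr (proj P) \<psi> = farr (proj P) \<phi>"
  shows "\<exists>!k. k \<in> hom (fibre P (fob (proj P) (dom (total P) \<psi>))) (dom (total P) \<psi>) (dom (total P) \<phi>) \<and>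
     \<phi> \<cdot>\<^bsub>total P\<^esub> k = \<psi>"
proof -
  interpret B: category "base P" by (rule base_category)
  have \<phi>: "\<phi> \<in> Arr (total P)" using assms by (simp add: is_cartesian_def)
  let ?A = "fob (proj P) (dom (total P) \<psi>)"
  have h1: "farr (proj P) \<psi> \<in> hom (base P) ?A (fob (proj P) (cod (total P) \<psi>))"
    by (rule is_functor.farr_hom[OF proj_functor]) (use assms in \<open>simp add: hom_def\<close>)
  have h2: "farr (proj P) \<phi> \<in> hom (base P) (fob (proj P) (dom (total P) \<phi>)) (fob (proj P) (cod (total P) \<phi>))"
    by (rule is_functor.farr_hom[OF proj_functor]) (use \<phi> in \<open>simp add: hom_def\<close>)
  \<comment> \<open>Both arrows have the same projection, so their domains lie over the same
    object.\<close>
  have A: "fob (proj P) (dom (total P) \<phi>) = ?A" using h1 h2 assms by (simp add: hom_def)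
  have "?A \<in> Ob (base P)" using h1 B.dom_ob[of "farr (proj P) \<psi>"] by (simp add: hom_def)
  then have "ide (base P) ?A \<in> hom (base P) ?A ?A" by (rule B.ide_hom)
  moreover have "farr (proj P) \<phi> \<cdot>\<^bsub>base P\<^esub> ide (base P) ?A = farr (proj P) \<psi>"
    using B.comp_ide_right[OF h2] A assms by simp
  ultimately have "\<exists>!k. k \<in> hom (total P) (dom (total P) \<psi>) (dom (total P) \<phi>) \<and>
      farr (proj P) k = ide (base P) ?A \<and> \<phi> \<cdot>\<^bsub>total P\<^esub> k = \<psi>"
    using assms A unfolding is_cartesian_def by simp
  then show ?thesis by (simp add: mem_hom_fibre_iff A conj_assoc)
qed

text \<open>Unique existence makes the definite description in \<open>vert_factor\<close> denote, so
  it has the properties that define it.\<close>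

lemma vert_factor:
  assumes "is_cartesian P \<phi>" "\<psi> \<in> Arr (total P)" "cod (total P) \<psi> = cod (total P) \<phi>"
    "farr (proj P) \<psi> = farr (proj P) \<phi>"
  shows "vert_factor P \<phi> \<psi> \<in>
      hom (fibre P (fob (proj P) (dom (total P) \<psi>))) (dom (total P) \<psi>) (dom (total P) \<phi>)"
    and "\<phi> \<cdot>\<^bsub>total P\<^esub> vert_factor P \<phi> \<psi> = \<psi>"
  using theI'[OF cartesian_vert_factor_ex1[OF assms]] by (simp_all add: vert_factor_def)

lemma cartesian_vertical_cancel:
  assumes \<phi>: "is_cartesian P \<phi>"
    and k: "k \<in> hom (fibre P A) X (dom (total P) \<phi>)" and l: "l \<in> hom (fibre P A) X (dom (total P) \<phi>)"
    and eq: "\<phi> \<cdot>\<^bsub>total P\<^esub> k = \<phi> \<cdot>\<^bsub>total P\<^esub> l"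
  shows "k = l"
proof -
  interpret T: category "total P" by (rule total_category)
  interpret B: category "base P" by (rule base_category)
  have h: "\<phi> \<in> hom (total P) (dom (total P) \<phi>) (cod (total P) \<phi>)"
    using \<phi> by (simp add: is_cartesian_def hom_def)
  have c: "\<phi> \<cdot>\<^bsub>total P\<^esub> k \<in> hom (total P) X (cod (total P) \<phi>)"
    using T.comp_hom k h by (auto simp: mem_hom_fibre_iff)
  have p: "farr (proj P) (\<phi> \<cdot>\<^bsub>total P\<^esub> k) = farr (proj P) \<phi>"
    using k h is_functor.farr_comp[OF proj_functor] is_functor.farr_hom[OF proj_functor h]
      B.comp_ide_right
    by (auto simp: mem_hom_fibre_iff)
  have X: "fob (proj P) X = A" using k by (simp add: mem_hom_fibre_iff)
  have d: "dom (total P) (\<phi> \<cdot>\<^bsub>total P\<^esub> k) = X" "cod (total P) (\<phi> \<cdot>\<^bsub>total P\<^esub> k) = cod (total P) \<phi>"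
    "\<phi> \<cdot>\<^bsub>total P\<^esub> k \<in> Arr (total P)"
    using c by (simp_all add: hom_def)
  \<comment> \<open>Both \<open>k\<close> and \<open>l\<close> satisfy the condition on
    \<open>m\<close>, the latter by \<open>eq\<close>.\<close>
  have "\<exists>!m. m \<in> hom (fibre P A) X (dom (total P) \<phi>) \<and> \<phi> \<cdot>\<^bsub>total P\<^esub> m = \<phi> \<cdot>\<^bsub>total P\<^esub> k"
    using cartesian_vert_factor_ex1[OF \<phi> d(3,2) p] unfolding d(1) X .
  then show ?thesis using k l eq by metis
qed

section \<open>Reindexing and its canonical isomorphisms\<close>

lemma lift_hom:
  assumes "u \<in> hom (base P) A B" "X \<in> Ob (fibre P B)"
  shows "lift P u X \<in> hom (total P) (fob (reindex P u) X) X"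
    and "farr (proj P) (lift P u X) = u"
    and "is_cartesian P (lift P u X)"
  using assms lift_arr lift_cod lift_proj lift_cartesian
  by (auto simp: hom_def mem_Ob_fibre_iff reindex_def)

lemma reindex_ob:
  assumes "u \<in> hom (base P) A B" "X \<in> Ob (fibre P B)"
  shows "fob (reindex P u) X \<in> Ob (fibre P A)"
  using hom_total_ob(1)[OF lift_hom(1)[OF assms]] lift_hom(2)[OF assms] assms(1)
    is_functor.farr_hom[OF proj_functor lift_hom(1)[OF assms]]
  by (simp add: mem_Ob_fibre_iff hom_def)

lemma lift_vert_factor_hom:
  assumes u: "u \<in> hom (base P) A B" and X: "X \<in> Ob (fibre P B)"
    and \<psi>: "\<psi> \<in> hom (total P) Y X" "farr (proj P) \<psi> = u"
  shows "vert_factor P (lift P u X) \<psi> \<in> hom (fibre P A) Y (fob (reindex P u) X)"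
proof -
  have "fob (proj P) Y = A"
    using is_functor.farr_hom[OF proj_functor \<psi>(1)] \<psi>(2) u by (simp add: hom_def)
  then show ?thesis
    using vert_factor(1)[OF lift_hom(3)[OF u X], of \<psi>] lift_hom[OF u X] \<psi> by (simp add: hom_def)
qed

lemma reindex_hom:
  assumes g: "g \<in> hom (base P) B A" and k: "k \<in> hom (fibre P A) X Y"
  shows "farr (reindex P g) k \<in> hom (fibre P B) (fob (reindex P g) X) (fob (reindex P g) Y)"
proof -
  interpret T: category "total P" by (rule total_category)
  interpret B: category "base P" by (rule base_category)
  note l = lift_hom[OF g hom_fibre_ob(1)[OF k]]
  have k': "k \<in> hom (total P) X Y" "farr (proj P) k = ide (base P) A"
    using k by (auto simp: mem_hom_fibre_iff)
  \<comment> \<open>The composite stays over \<open>g\<close> because \<open>k\<close> is vertical,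
    so it factors through the lift of \<open>g\<close> at \<open>Y\<close>.\<close>
  have "farr (proj P) (k \<cdot>\<^bsub>total P\<^esub> lift P g X) = g"
    using is_functor.farr_comp[OF proj_functor l(1) k'(1)] k'(2) l(2) B.comp_ide_left[OF g] by simp
  from lift_vert_factor_hom[OF g hom_fibre_ob(2)[OF k] T.comp_hom[OF l(1) k'(1)] this]
  show ?thesis using k' by (simp add: reindex_def hom_def)
qed

text \<open>The composite of the two lifts lies over the composite of \<open>u\<close> and
  \<open>g\<close>, hence factors vertically through the lift of that composite.\<close>

lemma reindex_comp_iso_hom:
  assumes u: "u \<in> hom (base P) A C" and g: "g \<in> hom (base P) B A" and X: "X \<in> Ob (fibre P C)"
  shows "reindex_comp_iso P u g X \<in>
    hom (fibre P B) (fob (reindex P g) (fob (reindex P u) X)) (fob (reindex P (u \<cdot>\<^bsub>base P\<^esub> g)) X)"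
proof -
  note l = lift_hom[OF u X] and l' = lift_hom[OF g reindex_ob[OF u X]]
  have "farr (proj P) (lift P u X \<cdot>\<^bsub>total P\<^esub> lift P g (fob (reindex P u) X)) = u \<cdot>\<^bsub>base P\<^esub> g"
    using is_functor.farr_comp[OF proj_functor l'(1) l(1)] l(2) l'(2) by simp
  from lift_vert_factor_hom[OF category.comp_hom[OF base_category g u] X
      category.comp_hom[OF total_category l'(1) l(1)] this]
  show ?thesis by (simp add: reindex_comp_iso_def)
qed

lemma lift_ide_hom:
  assumes "X \<in> Ob (fibre P A)"
  shows "lift P (ide (base P) A) X \<in> hom (fibre P A) (fob (reindex P (ide (base P) A)) X) X"
proof -
  have A: "ide (base P) A \<in> hom (base P) A A"
    by (rule category.ide_hom[OF base_category base_ob[OF assms]])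
  show ?thesis
    using lift_hom[OF A assms] reindex_ob[OF A assms] assms
    by (simp add: mem_hom_fibre_iff mem_Ob_fibre_iff)
qed

text \<open>For a section \<open>g\<close> the comparison arrow ends in the reindexing of
  \<open>X\<close> along the identity of \<open>C\<close>, and the lift of that identity leads on to
  \<open>X\<close>.\<close>

lemma section_iso_hom:
  assumes "u \<in> hom (base P) A C" "g \<in> hom (base P) C A" "u \<cdot>\<^bsub>base P\<^esub> g = ide (base P) C"
    and X: "X \<in> Ob (fibre P C)"
  shows "section_iso P u g X \<in> hom (fibre P C) (fob (reindex P g) (fob (reindex P u) X)) X"
proof -
  have "fob (proj P) X = C" using X by (simp add: mem_Ob_fibre_iff)
  then show ?thesis
    using category.comp_hom[OF fibre_category reindex_comp_iso_hom[OF assms(1,2) X]] lift_ide_hom[OF X]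
      assms(3)
    by (simp add: section_iso_def)
qed

text \<open>The cleavage is not assumed to be normalised, so reindexing along an identity need only
  return an isomorphic object. The inverse is the vertical factor of the identity of
  \<open>X\<close> through the lift.\<close>

lemma lift_ide_iso:
  assumes X: "X \<in> Ob (fibre P A)"
  shows "is_iso (fibre P A) (lift P (ide (base P) A) X)"
proof -
  interpret V: category "fibre P A" by (rule fibre_category)
  let ?i = "lift P (ide (base P) A) X"
  let ?X = "fob (reindex P (ide (base P) A)) X"
  let ?j = "vert_factor P ?i (ide (total P) X)"
  have A: "ide (base P) A \<in> hom (base P) A A"
    by (rule category.ide_hom[OF base_category base_ob[OF X]])
  note l = lift_hom[OF A X]
  have i: "?i \<in> hom (fibre P A) ?X X" by (rule lift_ide_hom[OF X])
  have d: "dom (total P) ?i = ?X" "cod (total P) ?i = X" using l(1) by (auto simp: hom_def)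
  have e: "ide (total P) X \<in> hom (total P) X X" "farr (proj P) (ide (total P) X) = ide (base P) A"
    using V.ide_hom[OF X] by (auto simp: mem_hom_fibre_iff)
  have j: "?j \<in> hom (fibre P A) X ?X" by (rule lift_vert_factor_hom[OF A X e])
  have ij: "?i \<cdot>\<^bsub>total P\<^esub> ?j = ide (total P) X"
    using vert_factor(2)[OF l(3), of "ide (total P) X"] e d l(2) by (simp add: hom_def)
  have X': "?X \<in> Ob (fibre P A)" by (rule reindex_ob[OF A X])
  have "?j \<cdot>\<^bsub>total P\<^esub> ?i = ide (total P) ?X"
  \<comment> \<open>After composing with \<open>?i\<close> both sides equal \<open>?i\<close>,
    because \<open>?i\<close> followed after \<open>?j\<close> is already the identity;
    cartesianness cancels \<open>?i\<close>.\<close>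
  proof (rule cartesian_vertical_cancel[OF l(3)])
    show "?j \<cdot>\<^bsub>total P\<^esub> ?i \<in> hom (fibre P A) ?X (dom (total P) ?i)"
      using V.comp_hom[OF i j] d by simp
    show "ide (total P) ?X \<in> hom (fibre P A) ?X (dom (total P) ?i)"
      using V.ide_hom[OF X'] d by simp
    show "?i \<cdot>\<^bsub>total P\<^esub> (?j \<cdot>\<^bsub>total P\<^esub> ?i) = ?i \<cdot>\<^bsub>total P\<^esub> ide (total P) ?X"
      using V.comp_assoc[OF i j i] ij V.comp_ide_left[OF i] V.comp_ide_right[OF i] by simp
  qed
  moreover have "?i \<in> Arr (fibre P A)" using i by (simp add: hom_def)
  ultimately show ?thesis
    using j ij d unfolding is_iso_def inverse_arrows_def by auto
qed

end

section \<open>The reindexed unit and transport of quantifier splitting\<close>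

text \<open>The arrow \<open>g\<^sup>* \<beta> \<rightarrow> g\<^sup>* u\<^sup>* (\<Coprod>\<^sub>u \<beta>) \<cong> \<Coprod>\<^sub>u \<beta>\<close>.\<close>

definition section_unit ::
  "('bo, 'ba, 'eo, 'ea) fibration \<Rightarrow> ('ba, 'eo, 'ea) coproducts \<Rightarrow> 'ba \<Rightarrow> 'ba \<Rightarrow> 'eo \<Rightarrow> 'ea" where
  "section_unit P Q u g \<beta> =
     section_iso P u g (fob (coprod Q u) \<beta>) \<cdot>\<^bsub>total P\<^esub> farr (reindex P g) (unit Q u \<beta>)"

context fibred_coproducts
begin

lemma coprod_ob:
  assumes "u \<in> F" "u \<in> hom (base P) B A" "\<beta> \<in> Ob (fibre P B)"
  shows "fob (coprod Q u) \<beta> \<in> Ob (fibre P A)"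
  using is_functor.fob_ob[OF adjunction.left_functor[OF coprod_adjunction[OF assms(1)]]] assms(2,3)
  by (auto simp: hom_def)

lemma unit_hom:
  assumes "u \<in> F" "u \<in> hom (base P) B A" "\<beta> \<in> Ob (fibre P B)"
  shows "unit Q u \<beta> \<in> hom (fibre P B) \<beta> (fob (reindex P u) (fob (coprod Q u) \<beta>))"
  using nat_trans.component[OF adjunction.unit_nat[OF coprod_adjunction[OF assms(1)]], of \<beta>] assms(2,3)
  by (auto simp: hom_def id_func_def comp_func_def)

lemma section_unit_homs:
  assumes u: "u \<in> F" "u \<in> hom (base P) B A" and \<beta>: "\<beta> \<in> Ob (fibre P B)"
    and g: "g \<in> hom (base P) A B" "u \<cdot>\<^bsub>base P\<^esub> g = ide (base P) A"
  shows "farr (reindex P g) (unit Q u \<beta>) \<in> hom (fibre P A) (fob (reindex P g) \<beta>)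
      (fob (reindex P g) (fob (reindex P u) (fob (coprod Q u) \<beta>)))"
    and "section_unit P Q u g \<beta> \<in> hom (fibre P A) (fob (reindex P g) \<beta>) (fob (coprod Q u) \<beta>)"
proof -
  show *: "farr (reindex P g) (unit Q u \<beta>) \<in> hom (fibre P A) (fob (reindex P g) \<beta>)
      (fob (reindex P g) (fob (reindex P u) (fob (coprod Q u) \<beta>)))"
    by (rule reindex_hom[OF g(1) unit_hom[OF u \<beta>]])
  show "section_unit P Q u g \<beta> \<in> hom (fibre P A) (fob (reindex P g) \<beta>) (fob (coprod Q u) \<beta>)"
    using category.comp_hom[OF fibre_category * section_iso_hom[OF u(2) g coprod_ob[OF u \<beta>]]]
    by (simp add: section_unit_def)
qed

text \<open>Reassociating the triple composite turns a factorisation of \<open>h\<close> into one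
  through the single arrow \<open>section_unit P Q u g \<beta>\<close>, the form in which the later
  arguments compose and cancel.\<close>

lemma unit_factorisation_iff:
  assumes u: "u \<in> F" "u \<in> hom (base P) B A" and \<beta>: "\<beta> \<in> Ob (fibre P B)"
    and h: "h \<in> hom (fibre P A) \<alpha> Y"
  shows "unit_factorisation P Q u \<beta> h g k \<longleftrightarrow>
    g \<in> hom (base P) A B \<and> u \<cdot>\<^bsub>base P\<^esub> g = ide (base P) A \<and>
    k \<in> hom (fibre P A) \<alpha> (fob (reindex P g) \<beta>) \<and>
    h = section_unit P Q u g \<beta> \<cdot>\<^bsub>total P\<^esub> k"
proof -
  have d: "dom (base P) u = B" "cod (base P) u = A" "dom (total P) h = \<alpha>"
    using u h by (auto simp: hom_def)
  \<comment> \<open>Associativity holds only for composable arrows, hence the typing conditions on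
    \<open>g\<close> and \<open>k\<close>.\<close>
  have "section_unit P Q u g \<beta> \<cdot>\<^bsub>total P\<^esub> k =
      section_iso P u g (fob (coprod Q u) \<beta>) \<cdot>\<^bsub>total P\<^esub> farr (reindex P g) (unit Q u \<beta>) \<cdot>\<^bsub>total P\<^esub> k"
    if "g \<in> hom (base P) A B" "u \<cdot>\<^bsub>base P\<^esub> g = ide (base P) A"
      "k \<in> hom (fibre P A) \<alpha> (fob (reindex P g) \<beta>)"
    using category.comp_assoc[OF fibre_category that(3) section_unit_homs(1)[OF u \<beta> that(1,2)]
        section_iso_hom[OF u(2) that(1,2) coprod_ob[OF u \<beta>]]]
    by (simp add: section_unit_def)
  then show ?thesis unfolding unit_factorisation_def d by auto
qed

text \<open>Precomposition with \<open>i\<close> is a bijection from the factorisations of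
  \<open>h\<close> to those of \<open>h\<close> after \<open>i\<close>, and it keeps the section.
  The assumption \<open>arr\<close> supplies that display maps are arrows of the base, which the
  present locale does not state.\<close>

lemma quantifier_splitting_iso:
  assumes arr: "F \<subseteq> Arr (base P)"
    and split: "quantifier_splitting P F Q \<alpha>'"
    and i: "i \<in> hom (fibre P A) \<alpha>' \<alpha>" and iso: "is_iso (fibre P A) i"
  shows "quantifier_splitting P F Q \<alpha>"
  unfolding quantifier_splitting_def
proof (intro ballI impI)
  interpret V: category "fibre P A" by (rule fibre_category)
  fix u \<beta> h
  assume u: "u \<in> F" and cu: "cod (base P) u = fob (proj P) \<alpha>"
    and \<beta>: "\<beta> \<in> Ob (fibre P (dom (base P) u))"
    and h: "h \<in> hom (fibre P (cod (base P) u)) \<alpha> (fob (coprod Q u) \<beta>)"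
  obtain j where "inverse_arrows (fibre P A) i j" using iso by (auto simp: is_iso_def)
  note j = inverse_arrowsD[OF this i, simplified]
  have p: "fob (proj P) \<alpha> = A" "fob (proj P) \<alpha>' = A" using i by (auto simp: mem_hom_fibre_iff)
  let ?B = "dom (base P) u"
  have u': "u \<in> hom (base P) ?B A"
    using arr u cu p by (auto simp: hom_def)
  have h': "h \<in> hom (fibre P A) \<alpha> (fob (coprod Q u) \<beta>)" using h cu p by simp
  have hi: "h \<cdot>\<^bsub>total P\<^esub> i \<in> hom (fibre P A) \<alpha>' (fob (coprod Q u) \<beta>)"
    using V.comp_hom[OF i h'] by simp
  note iff = unit_factorisation_iff[OF u u' \<beta>]
  \<comment> \<open>From \<open>h\<close> to \<open>h\<close> after \<open>i\<close>: precompose the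
    vertical part with \<open>i\<close>.\<close>
  have 1: "unit_factorisation P Q u \<beta> (h \<cdot>\<^bsub>total P\<^esub> i) g (k \<cdot>\<^bsub>total P\<^esub> i)"
    if "unit_factorisation P Q u \<beta> h g k" for g k
  proof -
    from that have g: "g \<in> hom (base P) A ?B" "u \<cdot>\<^bsub>base P\<^esub> g = ide (base P) A"
      and k: "k \<in> hom (fibre P A) \<alpha> (fob (reindex P g) \<beta>)"
      and eq: "h = section_unit P Q u g \<beta> \<cdot>\<^bsub>total P\<^esub> k"
      by (auto simp: iff[OF h'])
    show ?thesis
      unfolding iff[OF hi]
      using g V.comp_hom[OF i k] V.comp_assoc[OF i k section_unit_homs(2)[OF u u' \<beta> g]] eq
      by simp
  qed
  \<comment> \<open>The reverse passage precomposes with the inverse \<open>j\<close>.\<close>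
  have 2: "unit_factorisation P Q u \<beta> h g (k \<cdot>\<^bsub>total P\<^esub> j)"
    if "unit_factorisation P Q u \<beta> (h \<cdot>\<^bsub>total P\<^esub> i) g k" for g k
  proof -
    from that have g: "g \<in> hom (base P) A ?B" "u \<cdot>\<^bsub>base P\<^esub> g = ide (base P) A"
      and k: "k \<in> hom (fibre P A) \<alpha>' (fob (reindex P g) \<beta>)"
      and eq: "h \<cdot>\<^bsub>total P\<^esub> i = section_unit P Q u g \<beta> \<cdot>\<^bsub>total P\<^esub> k"
      by (auto simp: iff[OF hi])
    have "h = (h \<cdot>\<^bsub>total P\<^esub> i) \<cdot>\<^bsub>total P\<^esub> j"
      using V.comp_assoc[OF j(1) i h'] j(3) V.comp_ide_right[OF h'] by simp
    then have "h = section_unit P Q u g \<beta> \<cdot>\<^bsub>total P\<^esub> (k \<cdot>\<^bsub>total P\<^esub> j)"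
      using V.comp_assoc[OF j(1) k section_unit_homs(2)[OF u u' \<beta> g]] unfolding eq by simp
    then show ?thesis
      unfolding iff[OF h'] using g V.comp_hom[OF j(1) k] by simp
  qed
  have ex1: "\<exists>!(g, k). unit_factorisation P Q u \<beta> (h \<cdot>\<^bsub>total P\<^esub> i) g k"
    using split u cu p \<beta> hi unfolding quantifier_splitting_def by simp
  then obtain g k where gk: "unit_factorisation P Q u \<beta> (h \<cdot>\<^bsub>total P\<^esub> i) g k" by auto
  show "\<exists>!(g, k). unit_factorisation P Q u \<beta> h g k"
  proof (rule ex1I[of _ "(g, k \<cdot>\<^bsub>total P\<^esub> j)"])
    show "case (g, k \<cdot>\<^bsub>total P\<^esub> j) of (g, k) \<Rightarrow> unit_factorisation P Q u \<beta> h g k"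
      using 2[OF gk] by simp
  next
    fix x assume "case x of (g, k) \<Rightarrow> unit_factorisation P Q u \<beta> h g k"
    then obtain g' k' where x: "x = (g', k')" and f: "unit_factorisation P Q u \<beta> h g' k'"
      by (cases x) auto
    have eq: "g' = g" "k' \<cdot>\<^bsub>total P\<^esub> i = k" using ex1 1[OF f] gk by auto
    have k': "k' \<in> hom (fibre P A) \<alpha> (fob (reindex P g') \<beta>)" using f by (simp add: iff[OF h'])
    \<comment> \<open>\<open>k'\<close> is recovered from its composite with \<open>i\<close>, so
      uniqueness for \<open>h\<close> after \<open>i\<close> gives uniqueness for
      \<open>h\<close>.\<close>
    have "k' = (k' \<cdot>\<^bsub>total P\<^esub> i) \<cdot>\<^bsub>total P\<^esub> j"
      using V.comp_assoc[OF j(1) i k'] j(3) V.comp_ide_right[OF k'] by simp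
    with x eq show "x = (g, k \<cdot>\<^bsub>total P\<^esub> j)" by simp
  qed
qed

end

section \<open>The epsilon section and the inverse of the epsilon arrow\<close>

context dependent_hilbert_fibration
begin

lemma reindex_quantifier_splitting:
  assumes "g \<in> hom (base P) A B" "\<alpha> \<in> Ob (fibre P B)"
  shows "quantifier_splitting P F Q (fob (reindex P g) \<alpha>)"
  using all_quantifier_free[of \<alpha>] assms by (auto simp: quantifier_free_def hom_def mem_Ob_fibre_iff)

text \<open>Quantifier-freeness at the identity speaks of the reindexing of \<alpha> along it; the
  isomorphism from there to \<alpha> carries the splitting over.\<close>

lemma all_quantifier_splitting:
  assumes "\<alpha> \<in> Ob (fibre P A)"
  shows "quantifier_splitting P F Q \<alpha>"
proof -
  have "ide (base P) A \<in> hom (base P) A A"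
    by (rule category.ide_hom[OF base_category base_ob[OF assms]])
  from quantifier_splitting_iso[OF display_arr reindex_quantifier_splitting[OF this assms] lift_ide_hom[OF assms]
      lift_ide_iso[OF assms]]
  show ?thesis .
qed

lemma unit_factorisation_ex1:
  assumes "u \<in> F" "u \<in> hom (base P) B A" "\<beta> \<in> Ob (fibre P B)"
    and "h \<in> hom (fibre P A) \<alpha> (fob (coprod Q u) \<beta>)"
  shows "\<exists>!(g, k). unit_factorisation P Q u \<beta> h g k"
proof -
  have "dom (base P) u = B" "cod (base P) u = A" "fob (proj P) \<alpha> = A"
    using assms(2,4) unfolding mem_hom_fibre_iff by (simp_all add: hom_def)
  then show ?thesis
    using all_quantifier_splitting[OF hom_fibre_ob(1)[OF assms(4)]] assms
    by (simp add: quantifier_splitting_def)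
qed

text \<open>Splitting of \<open>fob (coprod Q f) \<alpha>\<close> itself, with its identity as
  \<open>h\<close>, makes the definite description in \<open>epsilon_pair\<close> denote.\<close>

lemma unit_factorisation_epsilon:
  assumes "f \<in> F" "f \<in> hom (base P) I J" "\<alpha> \<in> Ob (fibre P I)"
  shows "unit_factorisation P Q f \<alpha> (ide (total P) (fob (coprod Q f) \<alpha>))
    (epsilon P Q \<alpha> f) (epsilon_bar P Q \<alpha> f)"
proof -
  have "ide (total P) (fob (coprod Q f) \<alpha>) \<in> hom (fibre P J) (fob (coprod Q f) \<alpha>) (fob (coprod Q f) \<alpha>)"
    using category.ide_hom[OF fibre_category coprod_ob[OF assms]] by simp
  from theI'[OF unit_factorisation_ex1[OF assms this]] show ?thesis
    by (simp add: epsilon_def epsilon_bar_def epsilon_pair_def case_prod_unfold)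
qed

text \<open>Stated for any section \<open>g\<close> and any right inverse datum \<open>k\<close>, so
  that the definite description behind \<epsilon> does not enter the cancellation argument.\<close>

lemma section_unit_inverse:
  assumes f: "f \<in> F" "f \<in> hom (base P) I J" and \<alpha>: "\<alpha> \<in> Ob (fibre P I)"
    and g: "g \<in> hom (base P) J I" "f \<cdot>\<^bsub>base P\<^esub> g = ide (base P) J"
    and k: "k \<in> hom (fibre P J) (fob (coprod Q f) \<alpha>) (fob (reindex P g) \<alpha>)"
    and rk: "section_unit P Q f g \<alpha> \<cdot>\<^bsub>total P\<^esub> k = ide (total P) (fob (coprod Q f) \<alpha>)"
  shows "inverse_arrows (fibre P J) k (section_unit P Q f g \<alpha>)"
proof -
  interpret V: category "fibre P J" by (rule fibre_category)
  let ?r = "section_unit P Q f g \<alpha>"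
  have r: "?r \<in> hom (fibre P J) (fob (reindex P g) \<alpha>) (fob (coprod Q f) \<alpha>)"
    by (rule section_unit_homs(2)[OF f \<alpha> g])
  note iff = unit_factorisation_iff[OF f \<alpha> r]
  have "unit_factorisation P Q f \<alpha> ?r g (ide (total P) (fob (reindex P g) \<alpha>))"
    using g V.ide_hom[OF hom_fibre_ob(1)[OF r]] V.comp_ide_right[OF r] by (simp add: iff)
  moreover have "unit_factorisation P Q f \<alpha> ?r g (k \<cdot>\<^bsub>total P\<^esub> ?r)"
    using g V.comp_hom[OF r k] V.comp_assoc[OF r k r] rk V.comp_ide_left[OF r] by (simp add: iff)
  \<comment> \<open>Uniqueness is used with \<open>?r\<close> as \<open>h\<close>, whose domain is
    the reindexed object; comparing the second components of the two pairs gives the other inverse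
    law.\<close>
  ultimately have "k \<cdot>\<^bsub>total P\<^esub> ?r = ide (total P) (fob (reindex P g) \<alpha>)"
    using unit_factorisation_ex1[OF f \<alpha> r] by auto
  with rk r k show ?thesis by (auto simp: inverse_arrows_def hom_def)
qed

end

theorem corollary4p12:
  fixes P :: "('bo, 'ba, 'eo, 'ea) fibration" and F :: "'ba set"
    and Q :: "('ba, 'eo, 'ea) coproducts"
    and \<alpha> :: 'eo and I J :: 'bo and f :: 'ba
  assumes "display_map_category (base P) F"
    and "has_dependent_coproducts (base P) F"
    and "dependent_hilbert_fibration P F Q"
    and "\<alpha> \<in> Ob (fibre P I)"
    and "f \<in> F" and "f \<in> hom (base P) I J"
  shows "unit_factorisation P Q f \<alpha> (ide (total P) (fob (coprod Q f) \<alpha>))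
           (epsilon P Q \<alpha> f) (epsilon_bar P Q \<alpha> f)
    \<and> epsilon_bar P Q \<alpha> f
        \<in> hom (fibre P J) (fob (coprod Q f) \<alpha>) (fob (reindex P (epsilon P Q \<alpha> f)) \<alpha>)
    \<and> is_iso (fibre P J) (epsilon_bar P Q \<alpha> f)"
proof -
  interpret dependent_hilbert_fibration P F Q by (rule assms)
  have X: "ide (total P) (fob (coprod Q f) \<alpha>) \<in>
      hom (fibre P J) (fob (coprod Q f) \<alpha>) (fob (coprod Q f) \<alpha>)"
    using category.ide_hom[OF fibre_category coprod_ob[OF assms(5,6,4)]] by simp
  note u = unit_factorisation_epsilon[OF assms(5,6,4)]
  \<comment> \<open>Read with the identity as \<open>h\<close>, the factorisation says that the
    epsilon arrow is vertical and that the reindexed unit after it is the identity: the premises of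
    \<open>section_unit_inverse\<close>.\<close>
  note u' = u[unfolded unit_factorisation_iff[OF assms(5,6,4) X]]
  have "is_iso (fibre P J) (epsilon_bar P Q \<alpha> f)"
    unfolding is_iso_def using section_unit_inverse[OF assms(5,6,4)] u' by metis
  with u u' show ?thesis by blast
qed

end
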